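(* Let $t$, $n$, and $\ell$ be positive integers, let $q$ be a prime power, and let $\mu$ be a normalized measure on $\mathbb{R}^n$ with finite moments. For each $1 \le i \le \ell$, let $F_i \subset \mathbb{R}^n$ be an equal-weight formula with $q$ elements such that the convolution $$F = F_1 * F_2 * \cdots * F_\ell$$ is a $t$-cubature formula for $\mu$. If there is an $[\ell,k,t+1]_q$ code $C$, then there is a thinning $G \subset F$ with $q^{\ell-k}$ points (counted with multiplicity). In addition, suppose that each $F_i$ is centrally symmetric, that $t$ is odd, and that $C$ is an $[\ell,k,t]_q$ code such that either $q$ is odd or $C$ is a zero-sum code. Then there is again a thinning $G \subset F$ with $q^{\ell-k}$ points (counted with multiplicity).
   Context: A formula is a finite set of points $F=\{\vec p_a\}\subset\mathbb{R}^n$ together with weights $w_a\in\mathbb{R}$; it acts on polynomials by $P(F)=\sum_a w_aP(\vec p_a)$. It is a $t$-cubature formula for a normalized (total mass 1) measure $\mu$ on $\mathbb{R}^n$ with finite moments if $\int P\,d\mu = P(F)$ for all polynomials $P$ on $\mathbb{R}^n$ of degree at most $t$. It is equal-weight if all $w_a$ are equal. It is centrally symmetric if it is invariant under $\vec x\mapsto-\vec x$. The convolution $F*G$ of two formulas is the sumset $F+G$, where the weight of a point $\vec p_a$ is $\sum w_bw_c$ over all $\vec p_b\in F$, $\vec p_c\in G$ with $\vec p_b+\vec p_c=\vec p_a$. Thus $F_1*\cdots*F_\ell$ is regarded as the equal-weight family of sums $\vec p_1+\cdots+\vec p_\ell$ indexed by $(\vec p_1,\dots,\vec p_\ell)\in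 F_1\times\cdots\times F_\ell$, with coinciding sums counted with multiplicity. Thinning a formula means removing some of its points without reducing its cubature degree. So a thinning $G$ of $F=F_1*\cdots*F_\ell$ with $N$ points is given by a subset $A\subset F_1\times\cdots\times F_\ell$ with $|A|=N$, such that the sums $\vec p_1+\cdots+\vec p_\ell$ for $(\vec p_1,\dots,\vec p_\ell)\in A$, each with weight $1/N$, form a $t$-cubature formula for $\mu$. An $[\ell,k,d]_q$ code is a $k$-dimensional linear subspace $C\subset\mathbb{F}_q^\ell$ such that every non-zero vector of $C$ has at least $d$ non-zero coordinates. It is a zero-sum code if the coordinates of every vector of $C$ sum to $0$ in $\mathbb{F}_q$. *)

theory Defs
  imports "HOL-Analysis.Analysis" "HOL-Probability.Probability_Measure"
begin

text \<open>The weight function is only meaningful on the points of the formula.\<close>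
datatype 'a formula = Formula (points: "'a set") (weight: "'a \<Rightarrow> real")

definition eval_formula :: "'a formula \<Rightarrow> ('a \<Rightarrow> real) \<Rightarrow> real" where
  "eval_formula F P = (\<Sum>p\<in>points F. weight F p * P p)"

text \<open>The formula given by the weighted family of points \<open>f a\<close>, \<open>a \<in> I\<close>, where the weights of
  coinciding points are added up.\<close>
definition family_formula :: "'i set \<Rightarrow> ('i \<Rightarrow> real) \<Rightarrow> ('i \<Rightarrow> 'a) \<Rightarrow> 'a formula" where
  "family_formula I w f = Formula (f ` I) (\<lambda>p. \<Sum>a\<in>{a\<in>I. f a = p}. w a)"

definition monom_fun :: "('n::finite \<Rightarrow> nat) \<Rightarrow> real^'n \<Rightarrow> real" where
  "monom_fun \<alpha> x = (\<Prod>i\<in>UNIV. (x $ i) ^ \<alpha> i)"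

text \<open>The set of exponents is finite, since \<^typ>\<open>'n\<close> is.\<close>
definition polys_deg_le :: "nat \<Rightarrow> (real^'n::finite \<Rightarrow> real) set" where
  "polys_deg_le t =
     {P. \<exists>c. P = (\<lambda>x. \<Sum>\<alpha>\<in>{\<alpha>. (\<Sum>i\<in>UNIV. \<alpha> i) \<le> t}. c \<alpha> * monom_fun \<alpha> x)}"

definition finite_moments :: "(real^'n::finite) measure \<Rightarrow> bool" where
  "finite_moments \<mu> \<longleftrightarrow> (\<forall>\<alpha>. integrable \<mu> (monom_fun \<alpha>))"

definition cubature :: "nat \<Rightarrow> (real^'n::finite) measure \<Rightarrow> (real^'n) formula \<Rightarrow> bool" where
  "cubature t \<mu> F \<longleftrightarrow>
     finite (points F) \<and> (\<forall>P\<in>polys_deg_le t. integral\<^sup>L \<mu> P = eval_formula F P)"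

definition equal_weight :: "'a formula \<Rightarrow> bool" where
  "equal_weight F \<longleftrightarrow> (\<exists>w. \<forall>p\<in>points F. weight F p = w)"

definition centrally_symmetric :: "'a::real_vector formula \<Rightarrow> bool" where
  "centrally_symmetric F \<longleftrightarrow>
     uminus ` points F = points F \<and> (\<forall>p\<in>points F. weight F (- p) = weight F p)"

text \<open>\<open>F\<^sub>1 \<times> \<dots> \<times> F\<^sub>\<ell>\<close>; the index set \<open>{1, \<dots>, \<ell>}\<close> is the finite type \<^typ>\<open>'l\<close>.\<close>
definition tuples :: "('l::finite \<Rightarrow> 'a formula) \<Rightarrow> ('l \<Rightarrow> 'a) set" where
  "tuples F = {a. \<forall>i. a i \<in> points (F i)}"

definition tuple_sum :: "('l::finite \<Rightarrow> 'a::real_vector) \<Rightarrow> 'a" where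
  "tuple_sum a = (\<Sum>i\<in>UNIV. a i)"

text \<open>The iterated convolution \<open>F\<^sub>1 * \<dots> * F\<^sub>\<ell>\<close>: its points form the iterated sumset, and the weight
  of a point \<open>p\<close> is the sum of \<open>w\<^sub>1(p\<^sub>1) \<cdots> w\<^sub>\<ell>(p\<^sub>\<ell>)\<close> over all tuples with \<open>p\<^sub>1 + \<dots> + p\<^sub>\<ell> = p\<close>.\<close>
definition convolution :: "('l::finite \<Rightarrow> 'a::real_vector formula) \<Rightarrow> 'a formula" where
  "convolution F = family_formula (tuples F) (\<lambda>a. \<Prod>i\<in>UNIV. weight (F i) (a i)) tuple_sum"

text \<open>A thinning of \<open>convolution F\<close> with \<open>N\<close> points is given by the set \<open>A\<close> of the tuples that are
  kept, so that points are counted with multiplicity; each kept tuple has weight \<open>1 / N\<close>.\<close>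
definition thinning ::
  "nat \<Rightarrow> (real^'n::finite) measure \<Rightarrow> ('l::finite \<Rightarrow> (real^'n) formula) \<Rightarrow> nat
     \<Rightarrow> ('l \<Rightarrow> real^'n) set \<Rightarrow> bool" where
  "thinning t \<mu> F N A \<longleftrightarrow>
     A \<subseteq> tuples F \<and> finite A \<and> card A = N \<and>
     cubature t \<mu> (family_formula A (\<lambda>_. 1 / real N) tuple_sum)"

text \<open>An \<open>[\<ell>, k, d]\<^sub>q\<close> code, where \<open>\<ell> = CARD('l)\<close> and \<open>q = CARD('k)\<close>.\<close>
definition linear_code :: "nat \<Rightarrow> nat \<Rightarrow> ('k::{field,finite}^'l::finite) set \<Rightarrow> bool" where
  "linear_code k d C \<longleftrightarrow>
     vec.subspace C \<and> vec.dim C = k \<and> (\<forall>v\<in>C. v \<noteq> 0 \<longrightarrow> d \<le> card {i. v $ i \<noteq> 0})"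

definition zero_sum_code :: "('k::{field,finite}^'l::finite) set \<Rightarrow> bool" where
  "zero_sum_code C \<longleftrightarrow> (\<forall>v\<in>C. (\<Sum>i\<in>UNIV. v $ i) = 0)"

end

theory Submission
  imports Defs "HOL-Number_Theory.Residues"
begin

text \<open>
  Since all tuples of the convolution carry the same weight, the convolution is the plain average
  over the tuples. Labelling the points of each \<open>F\<^sub>i\<close> by the elements of the field with \<open>q\<close> elements
  identifies tuples with words of length \<open>\<ell>\<close>, and the tuples to keep are those labelled by the dual
  code of \<open>C\<close>, which has \<open>q\<^bsup>\<ell>-k\<^esup>\<close> words. A monomial of degree \<open>s\<close>, evaluated at the sum of a tuple,
  expands into terms that each depend on at most \<open>s\<close> entries of the tuple, so it is enough that a
  word drawn uniformly from the dual code has uniformly distributed restrictions to any \<open>s\<close>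
  coordinates, i.e. that the dual code is an orthogonal array of strength \<open>s\<close>.

  This is where the minimum distance enters (\<open>dual_code_orthogonal_array\<close>). If every non-zero word
  of \<open>C\<close> has more than \<open>s\<close> non-zero coordinates, then \<open>C\<close> meets the span of any \<open>s\<close> unit vectors only
  in \<open>0\<close>, so a basis of \<open>C\<close> stays independent when these unit vectors are added. Words of the dual
  code with prescribed values at the \<open>s\<close> coordinates are thus the solutions of \<open>k + s\<close> independent
  linear equations, and their number does not depend on the prescribed values.

  In the centrally symmetric case the distance \<open>t\<close> only gives strength \<open>t - 1\<close>, and the monomials of
  the odd degree \<open>t\<close> are handled by symmetry: their sum over a centrally symmetric family of points
  is \<open>0\<close>. For the kept family to be centrally symmetric, negation of the points of \<open>F\<^sub>i\<close> has to
  correspond to an involution of the field that preserves the dual code when it is applied to every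
  coordinate. If \<open>q\<close> is odd, this involution is negation; in characteristic two it is \<open>c \<mapsto> c + 1\<close>,
  which preserves the dual code because the all-ones word is orthogonal to a zero-sum code.
\<close>

section \<open>Systems of independent linear equations over a finite field\<close>

definition dot :: "'k::field^'l::finite \<Rightarrow> 'k^'l \<Rightarrow> 'k" where
  "dot u x = (\<Sum>i\<in>UNIV. u $ i * x $ i)"

lemma dot_axis [simp]: "dot (axis i 1) x = x $ i"
proof -
  have "dot (axis i 1) x = (\<Sum>j\<in>UNIV. if j = i then x $ j else 0)"
    unfolding dot_def by (intro sum.cong) (auto simp: axis_def)
  thus ?thesis by simp
qed

lemma dot_diff_right: "dot u (x - y) = dot u x - dot u y"
  by (simp add: dot_def algebra_simps sum_subtractf)

lemma dot_span_eq_0: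
  assumes "\<And>b. b \<in> B \<Longrightarrow> dot b x = 0" and "v \<in> vec.span B"
  shows "dot v x = 0"
  using assms(2)
proof (induction rule: vec.span_induct)
  case base
  show ?case
    by (auto simp: vec.subspace_def dot_def algebra_simps sum.distrib simp flip: sum_distrib_left)
next
  case (step b)
  thus ?case using assms(1) by simp
qed

lemma independent_card_le:
  assumes "vec.independent (B :: ('k::{field,finite}^'l::finite) set)"
  shows "card B \<le> CARD('l)"
  using vec.dim_subset[OF subset_UNIV, of B] vec.dim_eq_card_independent[OF assms]
  unfolding vec_dim_card by simp

text \<open>
  Extended to a basis of the whole space, the left hand sides give a linear coordinate system, which
  is injective and hence, by counting, bijective. The solutions are the words for which the
  coordinates belonging to \<open>B\<close> are prescribed and all others are free.
\<close>
lemma card_independent_system: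
  fixes B :: "('k::{field,finite}^'l::finite) set"
  assumes "vec.independent B"
  shows "card {x. \<forall>b\<in>B. dot b x = c b} = CARD('k) ^ (CARD('l) - card B)"
proof -
  define B' where "B' = vec.extend_basis B"
  have sub: "B \<subseteq> B'" and ind: "vec.independent B'" and span: "vec.span B' = UNIV"
    unfolding B'_def
    using vec.extend_basis_superset[OF assms] vec.independent_extend_basis[OF assms]
      vec.span_extend_basis[OF assms] by auto
  have card: "card B' = CARD('l)"
    using vec.dim_eq_card_independent[OF ind] vec.dim_span[of B'] span vec_dim_card by metis
  define f where "f = (\<lambda>x. restrict (\<lambda>b. dot b x) B')"
  have inj: "inj f"
  proof (rule injI)
    fix x y assume "f x = f y"
    hence eq: "dot b (x - y) = 0" if "b \<in> B'" for b
      using that unfolding f_def dot_diff_right by (metis restrict_apply' right_minus_eq)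
    have "dot v (x - y) = 0" for v
      using dot_span_eq_0[OF eq] span by simp
    from this[of "axis _ 1"] show "x = y"
      by (simp add: vec_eq_iff)
  qed
  have range: "range f = (\<Pi>\<^sub>E b\<in>B'. UNIV)"
  proof (rule card_subset_eq)
    show "range f \<subseteq> (\<Pi>\<^sub>E b\<in>B'. UNIV)" by (auto simp: f_def)
    show "card (range f) = card (\<Pi>\<^sub>E b\<in>B'. UNIV :: 'k set)"
      using inj by (simp add: card_image card_PiE card)
  qed (auto intro: finite_PiE)
  have image: "f ` {x. \<forall>b\<in>B. dot b x = c b} = (\<Pi>\<^sub>E b\<in>B'. if b \<in> B then {c b} else UNIV)" (is "?L = ?R")
  proof (intro equalityI subsetI)
    fix g assume "g \<in> ?L"
    thus "g \<in> ?R" by (auto simp: f_def)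
  next
    fix g assume g: "g \<in> ?R"
    hence "g \<in> range f" unfolding range by (auto simp: PiE_def)
    then obtain x where x: "g = f x" by auto
    have "dot b x = c b" if "b \<in> B" for b
      using PiE_mem[OF g, of b] that sub by (auto simp: x f_def)
    thus "g \<in> ?L" unfolding x by blast
  qed
  have "card {x. \<forall>b\<in>B. dot b x = c b} = card (f ` {x. \<forall>b\<in>B. dot b x = c b})"
    by (rule card_image[symmetric]) (rule inj_on_subset[OF inj subset_UNIV])
  also have "\<dots> = card (\<Pi>\<^sub>E b\<in>B'. if b \<in> B then {c b} else UNIV)"
    by (simp only: image)
  also have "\<dots> = (\<Prod>b\<in>B'. if b \<in> B then 1 else CARD('k))"
    by (subst card_PiE) (auto intro!: prod.cong)
  also have "\<dots> = CARD('k) ^ card (B' - B)"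
    by (subst prod.If_cases) (auto simp: Diff_eq)
  also have "card (B' - B) = CARD('l) - card B"
    using sub card by (simp add: card_Diff_subset)
  finally show ?thesis .
qed

section \<open>Dual codes as orthogonal arrays\<close>

definition dual_code :: "('k::field^'l::finite) set \<Rightarrow> ('k^'l) set" where
  "dual_code C = {x. \<forall>v\<in>C. dot v x = 0}"

text \<open>
  Every pattern on at most \<open>s\<close> coordinates occurs equally often in \<open>D\<close>. The product form avoids
  dividing \<open>card D\<close>, and it allows \<open>card S\<close> to be any number up to \<open>s\<close>, so that strength is
  monotone by definition.
\<close>
definition orthogonal_array :: "nat \<Rightarrow> ('k::finite^'l::finite) set \<Rightarrow> bool" where
  "orthogonal_array s D \<longleftrightarrow> (\<forall>S z. card S \<le> s \<longrightarrow>
     card {x \<in> D. \<forall>i\<in>S. x $ i = z $ i} * CARD('k) ^ card S = card D)"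

lemma span_axis_support:
  assumes "v \<in> vec.span ((\<lambda>i. axis i 1) ` S)" and "i \<notin> S"
  shows "v $ i = 0"
  using assms(1)
proof (induction rule: vec.span_induct)
  case base
  show ?case by (auto simp: vec.subspace_def)
next
  case (step b)
  thus ?case using assms(2) by (auto simp: axis_def)
qed

text \<open>
  The unit vectors are added one at a time. If \<open>axis s 1\<close> were a word \<open>v\<close> of the code plus a
  combination of unit vectors already present, then \<open>v\<close> would be supported on the chosen coordinates,
  hence be \<open>0\<close> by the distance condition, and \<open>axis s 1\<close> would be a combination of other unit vectors.
\<close>
lemma independent_basis_Un_axis:
  fixes B :: "('k::{field,finite}^'l::finite) set"
  assumes "vec.independent B"
    and "\<And>v. v \<in> vec.span B \<Longrightarrow> v \<noteq> 0 \<Longrightarrow> card S < card {i. v $ i \<noteq> 0}"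
  shows "vec.independent (B \<union> (\<lambda>i. axis i 1) ` S) \<and>
         card (B \<union> (\<lambda>i. axis i 1) ` S) = card B + card S"
proof -
  have "finite S" by simp
  thus ?thesis using assms(2)
  proof (induction S rule: finite_induct)
    case empty
    thus ?case using assms(1) by simp
  next
    case (insert s S)
    let ?E = "(\<lambda>i. axis i 1) ` S :: ('k^'l) set"
    have IH: "vec.independent (B \<union> ?E)" "card (B \<union> ?E) = card B + card S"
      using insert.IH insert.prems insert.hyps by (auto simp: Suc_lessD)
    have new: "axis s 1 \<notin> vec.span (B \<union> ?E)"
    proof
      assume "axis s 1 \<in> vec.span (B \<union> ?E)"
      then obtain v e where ve: "axis s 1 = v + e" "v \<in> vec.span B" "e \<in> vec.span ?E"
        by (auto simp: vec.span_Un)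
      have v: "v = axis s 1 - e" using ve(1) by simp
      have "v $ i = 0" if "i \<notin> insert s S" for i
        using that span_axis_support[OF ve(3), of i] by (auto simp: v axis_def)
      hence "{i. v $ i \<noteq> 0} \<subseteq> insert s S" by blast
      hence "card {i. v $ i \<noteq> 0} \<le> card (insert s S)" by (intro card_mono) auto
      with insert.prems[OF ve(2)] have "v = 0" by linarith
      hence "e $ s = 1" using ve(1) by (metis add_0 axis_nth)
      thus False using span_axis_support[OF ve(3)] insert.hyps by force
    qed
    hence "axis s 1 \<notin> B \<union> ?E" by (metis vec.span_base)
    hence "card (insert (axis s 1) (B \<union> ?E)) = Suc (card (B \<union> ?E))" by simp
    moreover have "vec.independent (insert (axis s 1) (B \<union> ?E))"
      using new IH(1) by (rule vec.independent_insertI)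
    ultimately show ?case using IH(2) insert.hyps by simp
  qed
qed

text \<open>
  Both counts are instances of \<open>card_independent_system\<close>: for a basis of the code, and for a basis
  of the code together with the unit vectors that read off the coordinates in \<open>S\<close>.
\<close>
lemma dual_code_orthogonal_array:
  fixes C :: "('k::{field,finite}^'l::finite) set"
  assumes "linear_code k (s + 1) C"
  shows "orthogonal_array s (dual_code C)" and "card (dual_code C) = CARD('k) ^ (CARD('l) - k)"
proof -
  have C: "vec.subspace C" "vec.dim C = k"
    and dist: "\<And>v. v \<in> C \<Longrightarrow> v \<noteq> 0 \<Longrightarrow> s < card {i. v $ i \<noteq> 0}"
    using assms by (auto simp: linear_code_def)
  obtain B where B: "B \<subseteq> C" "vec.independent B" "C \<subseteq> vec.span B" "card B = vec.dim C"
    using vec.basis_exists by blast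
  have span: "vec.span B = C"
    using B C(1) vec.span_minimal by blast
  have dual: "dual_code C = {x. \<forall>b\<in>B. dot b x = 0}"
    unfolding dual_code_def using B(1,3) dot_span_eq_0[of B] by blast
  show card_dual: "card (dual_code C) = CARD('k) ^ (CARD('l) - k)"
    unfolding dual using card_independent_system[OF B(2), of "\<lambda>_. 0"] B(4) C(2) by simp
  show "orthogonal_array s (dual_code C)"
    unfolding orthogonal_array_def
  proof (intro allI impI)
    fix S :: "'l set" and z :: "'k^'l"
    assume S: "card S \<le> s"
    define E where "E = (\<lambda>i. axis i 1 :: 'k^'l) ` S"
    have ind: "vec.independent (B \<union> E)" and card: "card (B \<union> E) = card B + card S"
      using independent_basis_Un_axis[OF B(2), of S] dist S unfolding span E_def
      by (meson le_less_trans)+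
    have "card E \<le> card S"
      unfolding E_def by (rule card_image_le) simp
    hence "card B + card E \<le> card (B \<union> E)"
      using card by simp
    hence disj: "B \<inter> E = {}"
      using card_Un_Int[of B E] by simp
    \<comment> \<open>The equations from \<open>B\<close> and from \<open>E\<close> have different right hand sides, which is consistent
      because no unit vector in \<open>E\<close> belongs to \<open>B\<close>.\<close>
    have "axis i 1 \<notin> B" if "i \<in> S" for i
      using that disj by (auto simp: E_def)
    hence "{x \<in> dual_code C. \<forall>i\<in>S. x $ i = z $ i} =
          {x. \<forall>b\<in>B \<union> E. dot b x = (if b \<in> B then 0 else dot b z)}"
      unfolding dual by (auto simp: E_def ball_Un)
    hence "card {x \<in> dual_code C. \<forall>i\<in>S. x $ i = z $ i} = CARD('k) ^ (CARD('l) - (k + card S))"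
      using card_independent_system[OF ind] card B(4) C(2) by simp
    moreover have "k + card S \<le> CARD('l)"
      using independent_card_le[OF ind] card B(4) C(2) by simp
    ultimately show "card {x \<in> dual_code C. \<forall>i\<in>S. x $ i = z $ i} * CARD('k) ^ card S
                     = card (dual_code C)"
      unfolding card_dual by (simp flip: power_add)
  qed
qed

text \<open>The full space is the dual of the zero code, which satisfies every distance condition.\<close>
lemma orthogonal_array_UNIV: "orthogonal_array s (UNIV :: ('k::{field,finite}^'l::finite) set)"
proof -
  have "linear_code 0 (s + 1) ({0} :: ('k^'l) set)"
    by (simp add: linear_code_def vec.subspace_def)
  from dual_code_orthogonal_array(1)[OF this] show ?thesis
    by (simp add: dual_code_def dot_def)
qed

section \<open>Averages over orthogonal arrays\<close>

text \<open>
  A function of at most \<open>s\<close> coordinates has the same average over any two orthogonal arrays of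
  strength \<open>s\<close>: both sides count, up to the factor \<open>q\<^bsup>|S|\<^esup>\<close>, the pairs of a word of \<open>D\<close> and a word of
  \<open>E\<close> that agree on \<open>S\<close>, weighted by the common value of \<open>g\<close>.
\<close>
lemma orthogonal_array_sum_eq:
  fixes D E :: "('k::finite^'l::finite) set" and g :: "'k^'l \<Rightarrow> real"
  assumes D: "orthogonal_array s D" and E: "orthogonal_array s E" and S: "card S \<le> s"
    and g: "\<And>x y. (\<And>i. i \<in> S \<Longrightarrow> x $ i = y $ i) \<Longrightarrow> g x = g y"
  shows "real (card E) * (\<Sum>x\<in>D. g x) = real (card D) * (\<Sum>y\<in>E. g y)"
proof -
  let ?q = "real (CARD('k) ^ card S)"
  have count: "real (card {y \<in> E. \<forall>i\<in>S. y $ i = x $ i}) * ?q = card E" if "orthogonal_array s E"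
    for E and x :: "'k^'l"
  proof -
    have "card {y \<in> E. \<forall>i\<in>S. y $ i = x $ i} * CARD('k) ^ card S = card E"
      using that S unfolding orthogonal_array_def by blast
    from arg_cong[OF this, of real] show ?thesis by simp
  qed
  have row: "real (card E) * (\<Sum>x\<in>D. g x)
             = ?q * (\<Sum>x\<in>D. \<Sum>y\<in>E. if \<forall>i\<in>S. y $ i = x $ i then g x else 0)"
    if "orthogonal_array s E" for D E
  proof -
    have "(\<Sum>y\<in>E. if \<forall>i\<in>S. y $ i = x $ i then g x else 0)
          = real (card {y \<in> E. \<forall>i\<in>S. y $ i = x $ i}) * g x" for x
      by (simp flip: sum.inter_filter)
    hence "?q * (\<Sum>y\<in>E. if \<forall>i\<in>S. y $ i = x $ i then g x else 0) = real (card E) * g x" for x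
      unfolding count[OF that, of x, symmetric] by (simp only: mult_ac)
    thus ?thesis by (simp add: sum_distrib_left)
  qed
  have "(\<Sum>x\<in>D. \<Sum>y\<in>E. if \<forall>i\<in>S. y $ i = x $ i then g x else 0)
        = (\<Sum>y\<in>E. \<Sum>x\<in>D. if \<forall>i\<in>S. x $ i = y $ i then g y else 0)"
    by (subst sum.swap, intro sum.cong refl if_cong g) auto
  thus ?thesis unfolding row[OF E, of D] row[OF D, of E] by (rule arg_cong)
qed

text \<open>
  The sum of the tuple labelled by the word \<open>x\<close>, where \<open>\<phi> i\<close> labels the points of the
  \<open>i\<close>-th formula by field elements.
\<close>
definition point_sum :: "('l \<Rightarrow> 'k \<Rightarrow> 'a) \<Rightarrow> 'k^'l::finite \<Rightarrow> 'a::comm_monoid_add" where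
  "point_sum \<phi> x = (\<Sum>i\<in>UNIV. \<phi> i (x $ i))"

lemma monom_fun_decrease:
  assumes "\<alpha> j > 0"
  shows "monom_fun \<alpha> x = x $ j * monom_fun (\<alpha>(j := \<alpha> j - 1)) x"
proof -
  have "monom_fun \<alpha> x = x $ j ^ \<alpha> j * (\<Prod>i\<in>UNIV - {j}. x $ i ^ \<alpha> i)"
    unfolding monom_fun_def by (subst prod.remove[of _ j]) auto
  moreover have "monom_fun (\<alpha>(j := \<alpha> j - 1)) x = x $ j ^ (\<alpha> j - 1) * (\<Prod>i\<in>UNIV - {j}. x $ i ^ \<alpha> i)"
    unfolding monom_fun_def by (subst prod.remove[of _ j]) auto
  ultimately show ?thesis
    using assms by (simp add: power_eq_if)
qed

text \<open>
  The extra factor \<open>g\<close> makes the induction on the degree work. Splitting off one variable of the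
  monomial gives a sum over \<open>i\<close> of functions of \<open>x $ i\<close>, and each of these is absorbed into \<open>g\<close>, which
  then depends on one more coordinate. So the degree plus the number of coordinates used by \<open>g\<close> never
  exceeds \<open>s\<close>.
\<close>
lemma orthogonal_array_monom_times:
  fixes D E :: "('k::finite^'l::finite) set" and \<phi> :: "'l \<Rightarrow> 'k \<Rightarrow> real^'n::finite"
  assumes D: "orthogonal_array s D" and E: "orthogonal_array s E"
    and "(\<Sum>i\<in>UNIV. \<alpha> i) + card S \<le> s"
    and "\<And>x y. (\<And>i. i \<in> S \<Longrightarrow> x $ i = y $ i) \<Longrightarrow> g x = g y"
  shows "real (card E) * (\<Sum>x\<in>D. monom_fun \<alpha> (point_sum \<phi> x) * g x)
       = real (card D) * (\<Sum>x\<in>E. monom_fun \<alpha> (point_sum \<phi> x) * g x)"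
  using assms(3,4)
proof (induction "\<Sum>i\<in>UNIV. \<alpha> i" arbitrary: \<alpha> S g)
  case 0
  have "monom_fun \<alpha> = (\<lambda>_. 1)"
    using "0.hyps" by (simp add: monom_fun_def fun_eq_iff)
  moreover have "real (card E) * (\<Sum>x\<in>D. g x) = real (card D) * (\<Sum>x\<in>E. g x)"
  proof (rule orthogonal_array_sum_eq[OF D E])
    show "card S \<le> s" using "0.prems"(1) by (rule add_leD2)
  qed (rule "0.prems"(2))
  ultimately show ?case by simp
next
  case (Suc m)
  have "\<exists>j. \<alpha> j > 0"
    using Suc.hyps(2) by (metis gr0I nat.distinct(1) sum.neutral)
  then obtain j where j: "\<alpha> j > 0" ..
  define \<beta> where "\<beta> = \<alpha>(j := \<alpha> j - 1)"
  have "(\<Sum>i\<in>UNIV. \<alpha> i) = \<alpha> j + (\<Sum>i\<in>UNIV - {j}. \<alpha> i)"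
    by (subst sum.remove[of _ j]) auto
  moreover have "(\<Sum>i\<in>UNIV. \<beta> i) = (\<alpha> j - 1) + (\<Sum>i\<in>UNIV - {j}. \<alpha> i)"
    unfolding \<beta>_def by (subst sum.remove[of _ j]) auto
  ultimately have deg: "(\<Sum>i\<in>UNIV. \<beta> i) = m"
    using j Suc.hyps(2) by linarith
  have expand: "(\<Sum>x\<in>X. monom_fun \<alpha> (point_sum \<phi> x) * g x)
      = (\<Sum>i\<in>UNIV. \<Sum>x\<in>X. monom_fun \<beta> (point_sum \<phi> x) * (\<phi> i (x $ i) $ j * g x))" for X
  proof -
    have "monom_fun \<alpha> (point_sum \<phi> x) * g x
          = (\<Sum>i\<in>UNIV. monom_fun \<beta> (point_sum \<phi> x) * (\<phi> i (x $ i) $ j * g x))" for x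
    proof -
      have "monom_fun \<alpha> (point_sum \<phi> x)
            = (\<Sum>i\<in>UNIV. \<phi> i (x $ i) $ j) * monom_fun \<beta> (point_sum \<phi> x)"
        unfolding \<beta>_def using monom_fun_decrease[of \<alpha> j, OF j] by (simp add: point_sum_def)
      thus ?thesis
        by (simp add: sum_distrib_left sum_distrib_right mult_ac)
    qed
    thus ?thesis by (simp add: sum.swap[of _ UNIV X])
  qed
  have step: "real (card E) * (\<Sum>x\<in>D. monom_fun \<beta> (point_sum \<phi> x) * (\<phi> i (x $ i) $ j * g x))
      = real (card D) * (\<Sum>x\<in>E. monom_fun \<beta> (point_sum \<phi> x) * (\<phi> i (x $ i) $ j * g x))" for i
  proof (rule Suc.hyps(1))
    show "m = (\<Sum>i\<in>UNIV. \<beta> i)" using deg ..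
    have "card (insert i S) \<le> Suc (card S)" by (simp add: card_insert_if)
    thus "(\<Sum>i\<in>UNIV. \<beta> i) + card (insert i S) \<le> s"
      using deg Suc.hyps(2) Suc.prems(1) by linarith
    show "\<phi> i (x $ i) $ j * g x = \<phi> i (y $ i) $ j * g y"
      if "\<And>i'. i' \<in> insert i S \<Longrightarrow> x $ i' = y $ i'" for x y
      using Suc.prems(2)[of x y] that by auto
  qed
  have "(\<Sum>i\<in>UNIV. real (card E) * (\<Sum>x\<in>D. monom_fun \<beta> (point_sum \<phi> x) * (\<phi> i (x $ i) $ j * g x)))
      = (\<Sum>i\<in>UNIV. real (card D) * (\<Sum>x\<in>E. monom_fun \<beta> (point_sum \<phi> x) * (\<phi> i (x $ i) $ j * g x)))"
    by (intro sum.cong refl step)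
  thus ?case unfolding expand sum_distrib_left[symmetric] .
qed

lemma orthogonal_array_monom:
  fixes D E :: "('k::finite^'l::finite) set" and \<phi> :: "'l \<Rightarrow> 'k \<Rightarrow> real^'n::finite"
  assumes "orthogonal_array s D" and "orthogonal_array s E" and "(\<Sum>i\<in>UNIV. \<alpha> i) \<le> s"
  shows "real (card E) * (\<Sum>x\<in>D. monom_fun \<alpha> (point_sum \<phi> x))
       = real (card D) * (\<Sum>x\<in>E. monom_fun \<alpha> (point_sum \<phi> x))"
  using orthogonal_array_monom_times[OF assms(1,2), of \<alpha> "{}" "\<lambda>_. 1"] assms(3) by simp

section \<open>Thinnings from sets of words\<close>

lemma eval_family_formula:
  assumes "finite I"
  shows "eval_formula (family_formula I w f) P = (\<Sum>a\<in>I. w a * P (f a))"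
proof -
  have "eval_formula (family_formula I w f) P
        = (\<Sum>p\<in>f ` I. \<Sum>a\<in>{a\<in>I. f a = p}. w a * P (f a))"
    unfolding eval_formula_def family_formula_def
    by (auto simp: sum_distrib_right intro!: sum.cong)
  thus ?thesis using sum.image_gen[OF assms, of "\<lambda>a. w a * P (f a)" f] by simp
qed

lemma const_in_polys_deg_le: "(\<lambda>_. 1) \<in> polys_deg_le t"
proof -
  have "{\<alpha> :: 'a \<Rightarrow> nat. (\<Sum>i\<in>UNIV. \<alpha> i) \<le> t} \<subseteq> (\<Pi>\<^sub>E i\<in>UNIV. {..t})"
  proof
    fix \<alpha> :: "'a \<Rightarrow> nat" assume "\<alpha> \<in> {\<alpha>. (\<Sum>i\<in>UNIV. \<alpha> i) \<le> t}"
    moreover have "\<alpha> i \<le> (\<Sum>i\<in>UNIV. \<alpha> i)" for i by (rule member_le_sum) auto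
    ultimately have "\<alpha> i \<le> t" for i by (metis mem_Collect_eq order_trans)
    thus "\<alpha> \<in> (\<Pi>\<^sub>E i\<in>UNIV. {..t})" by (simp add: PiE_UNIV_domain)
  qed
  hence fin: "finite {\<alpha> :: 'a \<Rightarrow> nat. (\<Sum>i\<in>UNIV. \<alpha> i) \<le> t}"
    by (rule finite_subset) (rule finite_PiE, auto)
  have "(\<Sum>\<alpha>\<in>{\<alpha>. (\<Sum>i\<in>UNIV. \<alpha> i) \<le> t}. (if \<alpha> = (\<lambda>_. 0) then 1 else 0) * monom_fun \<alpha> x) = 1"
    for x :: "real^'a"
  proof -
    have "(\<Sum>\<alpha>\<in>{\<alpha>. (\<Sum>i\<in>UNIV. \<alpha> i) \<le> t}. (if \<alpha> = (\<lambda>_. 0) then 1 else 0) * monom_fun \<alpha> x)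
          = (\<Sum>\<alpha>\<in>{\<alpha>. (\<Sum>i\<in>UNIV. \<alpha> i) \<le> t}. if \<alpha> = (\<lambda>_ :: 'a. 0) then 1 else 0)"
      by (intro sum.cong) (auto simp: monom_fun_def)
    thus ?thesis using fin by simp
  qed
  thus ?thesis unfolding polys_deg_le_def
    by (intro CollectI exI[of _ "\<lambda>\<alpha>. if \<alpha> = (\<lambda>_. 0) then 1 else 0"]) auto
qed

text \<open>
  This reduces the theorem to words: the cubature identity for the kept tuples only has to be
  compared, monomial by monomial, with the average over all words, because the convolution itself
  is that average.
\<close>
lemma thinning_of_words:
  fixes \<mu> :: "(real^'n::finite) measure" and F :: "'l::finite \<Rightarrow> (real^'n) formula"
    and \<phi> :: "'l \<Rightarrow> 'k::finite \<Rightarrow> real^'n" and D :: "('k^'l) set"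
  assumes "prob_space \<mu>" and eq: "\<And>i. equal_weight (F i)"
    and cub: "cubature t \<mu> (convolution F)"
    and \<phi>: "\<And>i. bij_betw (\<phi> i) UNIV (points (F i))"
    and "D \<noteq> {}"
    and avg: "\<And>\<alpha>. (\<Sum>i\<in>UNIV. \<alpha> i) \<le> t \<Longrightarrow>
           real CARD('k^'l) * (\<Sum>x\<in>D. monom_fun \<alpha> (point_sum \<phi> x))
         = real (card D) * (\<Sum>x\<in>UNIV. monom_fun \<alpha> (point_sum \<phi> x))"
  shows "thinning t \<mu> F (card D) ((\<lambda>x i. \<phi> i (x $ i)) ` D)"
proof -
  define T :: "'k^'l \<Rightarrow> 'l \<Rightarrow> real^'n" where "T = (\<lambda>x i. \<phi> i (x $ i))"
  have inj: "inj T"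
  proof (rule injI)
    fix x y assume "T x = T y"
    hence "\<phi> i (x $ i) = \<phi> i (y $ i)" for i by (auto simp: T_def fun_eq_iff)
    hence "x $ i = y $ i" for i using \<phi>[of i] by (metis bij_betw_def injD)
    thus "x = y" by (simp add: vec_eq_iff)
  qed
  have range: "range T = tuples F"
  proof (intro equalityI subsetI)
    fix a assume "a \<in> range T"
    thus "a \<in> tuples F" using \<phi> by (auto simp: T_def tuples_def bij_betw_def)
  next
    fix a assume a: "a \<in> tuples F"
    have "a i \<in> range (\<phi> i)" for i using a \<phi>[of i] by (auto simp: tuples_def bij_betw_def)
    hence "\<exists>c. a i = \<phi> i c" for i by blast
    then obtain x where "a i = \<phi> i (x i)" for i by metis
    hence "a = T (\<chi> i. x i)" by (auto simp: T_def)
    thus "a \<in> range T" by blast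
  qed
  have T_sum: "tuple_sum (T x) = point_sum \<phi> x" for x
    by (simp add: T_def tuple_sum_def point_sum_def)
  have fin: "finite (tuples F)" unfolding range[symmetric] by simp
  obtain w where w: "\<And>i p. p \<in> points (F i) \<Longrightarrow> weight (F i) p = w i"
    using eq unfolding equal_weight_def by metis
  define W where "W = (\<Prod>i\<in>UNIV. w i)"
  have eval_conv: "eval_formula (convolution F) P = W * (\<Sum>x\<in>UNIV. P (point_sum \<phi> x))" for P
  proof -
    have "eval_formula (convolution F) P
          = (\<Sum>a\<in>tuples F. (\<Prod>i\<in>UNIV. weight (F i) (a i)) * P (tuple_sum a))"
      unfolding convolution_def by (rule eval_family_formula[OF fin])
    also have "\<dots> = (\<Sum>a\<in>tuples F. W * P (tuple_sum a))"
      using w by (intro sum.cong) (auto simp: W_def tuples_def)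
    also have "\<dots> = (\<Sum>x\<in>UNIV. W * P (tuple_sum (T x)))"
      unfolding range[symmetric] by (simp add: sum.reindex[OF inj])
    finally show ?thesis by (simp add: T_sum sum_distrib_left)
  qed
  \<comment> \<open>Testing against the constant polynomial determines the common weight of the tuples.\<close>
  have "W * real CARD('k^'l) = 1"
  proof -
    interpret prob_space \<mu> by fact
    have "integral\<^sup>L \<mu> (\<lambda>_. 1) = eval_formula (convolution F) (\<lambda>_. 1)"
      using cub const_in_polys_deg_le unfolding cubature_def by blast
    thus ?thesis unfolding eval_conv by (simp add: prob_space)
  qed
  hence W: "W = 1 / real CARD('k^'l)" by (simp add: field_simps)
  have "card D > 0" using \<open>D \<noteq> {}\<close> by (simp add: card_gt_0_iff)
  have inj_D: "inj_on T D" using inj inj_on_subset by blast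
  let ?G = "family_formula (T ` D) (\<lambda>_. 1 / real (card D)) tuple_sum"
  have eval_G: "eval_formula ?G P = (\<Sum>x\<in>D. P (point_sum \<phi> x)) / real (card D)" for P
    by (subst eval_family_formula) (auto simp: sum.reindex[OF inj_D] T_sum sum_divide_distrib)
  have monom: "(\<Sum>x\<in>D. monom_fun \<alpha> (point_sum \<phi> x)) / real (card D)
        = W * (\<Sum>x\<in>UNIV. monom_fun \<alpha> (point_sum \<phi> x))" if "(\<Sum>i\<in>UNIV. \<alpha> i) \<le> t" for \<alpha>
    using avg[OF that] \<open>D \<noteq> {}\<close> by (simp add: W field_simps)
  have poly: "eval_formula ?G P = eval_formula (convolution F) P" if P_in: "P \<in> polys_deg_le t" for P
  proof -
    obtain c where P: "P = (\<lambda>x. \<Sum>\<alpha>\<in>{\<alpha>. (\<Sum>i\<in>UNIV. \<alpha> i) \<le> t}. c \<alpha> * monom_fun \<alpha> x)"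
      using P_in unfolding polys_deg_le_def by blast
    have "eval_formula ?G P = (\<Sum>\<alpha>\<in>{\<alpha>. (\<Sum>i\<in>UNIV. \<alpha> i) \<le> t}.
            c \<alpha> * ((\<Sum>x\<in>D. monom_fun \<alpha> (point_sum \<phi> x)) / real (card D)))"
      unfolding eval_G P
      by (simp add: sum.swap[of _ _ D] sum_distrib_left sum_divide_distrib)
    also have "\<dots> = (\<Sum>\<alpha>\<in>{\<alpha>. (\<Sum>i\<in>UNIV. \<alpha> i) \<le> t}.
            c \<alpha> * (W * (\<Sum>x\<in>UNIV. monom_fun \<alpha> (point_sum \<phi> x))))"
      using monom by (intro sum.cong) auto
    also have "\<dots> = W * (\<Sum>\<alpha>\<in>{\<alpha>. (\<Sum>i\<in>UNIV. \<alpha> i) \<le> t}.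
            \<Sum>x\<in>UNIV. c \<alpha> * monom_fun \<alpha> (point_sum \<phi> x))"
      by (simp add: sum_distrib_left mult_ac)
    also have "\<dots> = eval_formula (convolution F) P"
      unfolding eval_conv P by (subst sum.swap) simp
    finally show ?thesis .
  qed
  have "cubature t \<mu> ?G"
    using poly cub unfolding cubature_def by (simp add: family_formula_def)
  moreover have "T ` D \<subseteq> tuples F" using range by blast
  moreover have "card (T ` D) = card D" using inj_D by (rule card_image)
  ultimately show ?thesis unfolding thinning_def T_def by simp
qed

section \<open>Central symmetry\<close>

text \<open>
  With at most one fixed point on each side, the cardinality alone determines an involution up to
  conjugation, since its parity tells whether there is a fixed point. The induction matches one
  two-element orbit at a time; when none is left, both sets have at most one element.
\<close>
lemma equivariant_bijection:
  assumes "finite A" "finite B" "card A = card B"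
    and "\<And>x. x \<in> A \<Longrightarrow> f x \<in> A \<and> f (f x) = x"
    and "\<And>y. y \<in> B \<Longrightarrow> g y \<in> B \<and> g (g y) = y"
    and "\<And>x x'. x \<in> A \<Longrightarrow> x' \<in> A \<Longrightarrow> f x = x \<Longrightarrow> f x' = x' \<Longrightarrow> x = x'"
    and "\<And>y y'. y \<in> B \<Longrightarrow> y' \<in> B \<Longrightarrow> g y = y \<Longrightarrow> g y' = y' \<Longrightarrow> y = y'"
  shows "\<exists>h. bij_betw h A B \<and> (\<forall>x\<in>A. h (f x) = g (h x))"
  using assms
proof (induction "card A" arbitrary: A B rule: less_induct)
  case less
  note fin = less.prems(1,2) and card = less.prems(3)
  note f = less.prems(4) and g = less.prems(5)
  note f_fix = less.prems(6) and g_fix = less.prems(7)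
  show ?case
  proof (cases "\<exists>x\<in>A. f x \<noteq> x")
    case True
    then obtain x where x: "x \<in> A" "f x \<noteq> x" by blast
    have "\<exists>y\<in>B. g y \<noteq> y"
    proof (rule ccontr)
      assume "\<not> ?thesis"
      hence "\<And>y y'. y \<in> B \<Longrightarrow> y' \<in> B \<Longrightarrow> y = y'" using g_fix by blast
      hence "card B \<le> 1" by (metis card_le_Suc0_iff_eq fin(2) One_nat_def)
      moreover have "card {x, f x} \<le> card A" using x f fin by (intro card_mono) auto
      ultimately show False using x card by simp
    qed
    then obtain y where y: "y \<in> B" "g y \<noteq> y" by blast
    let ?A = "A - {x, f x}" and ?B = "B - {y, g y}"
    have cA: "card ?A = card A - 2" using x f fin by (subst card_Diff_subset) auto
    have cB: "card ?B = card B - 2" using y g fin by (subst card_Diff_subset) auto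
    have "card A > 0" using x fin by (auto simp: card_gt_0_iff)
    hence "card ?A < card A" using cA by simp
    moreover have "f z \<in> ?A \<and> f (f z) = z" if "z \<in> ?A" for z
      using that f x by (metis Diff_iff empty_iff insert_iff)
    moreover have "g z \<in> ?B \<and> g (g z) = z" if "z \<in> ?B" for z
      using that g y by (metis Diff_iff empty_iff insert_iff)
    ultimately have "\<exists>h. bij_betw h ?A ?B \<and> (\<forall>x\<in>?A. h (f x) = g (h x))"
      using fin card cA cB f_fix g_fix by (intro less.hyps) auto
    then obtain h where h: "bij_betw h ?A ?B" "\<forall>x\<in>?A. h (f x) = g (h x)" by blast
    define h' where "h' = h(x := y, f x := g y)"
    have "bij_betw h' ?A ?B"
      using h(1) by (rule iffD1[OF bij_betw_cong, rotated]) (auto simp: h'_def)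
    moreover have "bij_betw h' {x, f x} {y, g y}"
      using x y by (auto simp: bij_betw_def h'_def)
    ultimately have "bij_betw h' (?A \<union> {x, f x}) (?B \<union> {y, g y})"
      by (rule bij_betw_combine) auto
    moreover have "?A \<union> {x, f x} = A" "?B \<union> {y, g y} = B" using x y f g by auto
    ultimately have "bij_betw h' A B" by simp
    moreover have "h' (f z) = g (h' z)" if z: "z \<in> A" for z
    proof -
      consider "z = x" | "z = f x" | "z \<in> ?A" using z by blast
      thus ?thesis
      proof cases
        case 1
        thus ?thesis using x by (simp add: h'_def)
      next
        case 2
        thus ?thesis using x f[OF x(1)] g[OF y(1)] by (simp add: h'_def)
      next
        case 3
        hence "f z \<notin> {x, f x}" using f x by (metis Diff_iff insert_iff empty_iff)
        thus ?thesis using 3 h(2) by (auto simp: h'_def)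
      qed
    qed
    ultimately show ?thesis by blast
  next
    case False
    obtain h where h: "bij_betw h A B" using finite_same_card_bij[OF fin card] by blast
    have "h (f x) = g (h x)" if x: "x \<in> A" for x
    proof -
      have "A = {x}" using False f_fix x by blast
      hence "B = {h x}" using h by (auto simp: bij_betw_def)
      thus ?thesis using False x g by auto
    qed
    thus ?thesis using h by blast
  qed
qed

lemma monom_fun_uminus: "monom_fun \<alpha> (- x) = (- 1) ^ (\<Sum>i\<in>UNIV. \<alpha> i) * monom_fun \<alpha> x"
proof -
  have "monom_fun \<alpha> (- x) = (\<Prod>i\<in>UNIV. (- 1) ^ \<alpha> i * x $ i ^ \<alpha> i)"
    unfolding monom_fun_def by (intro prod.cong) (auto simp: power_minus[of "x $ _"])
  thus ?thesis by (simp add: prod.distrib power_sum monom_fun_def)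
qed

text \<open>
  Applying \<open>\<sigma>\<close> to all coordinates permutes \<open>D\<close> and negates the labelled points, hence negates
  odd monomials.
\<close>
lemma odd_monom_sum_eq_0:
  fixes D :: "('k::finite^'l::finite) set" and \<phi> :: "'l \<Rightarrow> 'k \<Rightarrow> real^'n::finite"
  assumes \<phi>: "\<And>i c. \<phi> i (\<sigma> c) = - \<phi> i c" and \<sigma>: "\<And>c. \<sigma> (\<sigma> c) = c"
    and D: "\<And>x. x \<in> D \<Longrightarrow> (\<chi> i. \<sigma> (x $ i)) \<in> D"
    and "odd (\<Sum>i\<in>UNIV. \<alpha> i)"
  shows "(\<Sum>x\<in>D. monom_fun \<alpha> (point_sum \<phi> x)) = 0"
proof -
  have "(\<Sum>x\<in>D. monom_fun \<alpha> (point_sum \<phi> x))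
        = (\<Sum>x\<in>D. monom_fun \<alpha> (point_sum \<phi> (\<chi> i. \<sigma> (x $ i))))"
    by (rule sum.reindex_bij_witness[of _ "\<lambda>x. \<chi> i. \<sigma> (x $ i)" "\<lambda>x. \<chi> i. \<sigma> (x $ i)"])
      (auto simp: D \<sigma>)
  also have "\<dots> = - (\<Sum>x\<in>D. monom_fun \<alpha> (point_sum \<phi> x))"
    using assms(4) by (simp add: point_sum_def \<phi> sum_negf monom_fun_uminus)
  finally show ?thesis by simp
qed

text \<open>
  Negation on a real vector space fixes only \<open>0\<close>, so \<open>equivariant_bijection\<close> applies to the points
  of a centrally symmetric formula.
\<close>
lemma exists_symmetric_labelling:
  fixes \<sigma> :: "'k::finite \<Rightarrow> 'k" and P :: "'a::real_vector set"
  assumes "finite P" "card P = CARD('k)" "uminus ` P = P"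
    and "\<And>c. \<sigma> (\<sigma> c) = c" and "\<And>c c'. \<sigma> c = c \<Longrightarrow> \<sigma> c' = c' \<Longrightarrow> c = c'"
  shows "\<exists>\<phi>. bij_betw \<phi> UNIV P \<and> (\<forall>c. \<phi> (\<sigma> c) = - \<phi> c)"
proof -
  have "\<exists>h. bij_betw h UNIV P \<and> (\<forall>x\<in>UNIV. h (\<sigma> x) = - h x)"
  proof (rule equivariant_bijection)
    show "- y \<in> P \<and> - (- y) = y" if "y \<in> P" for y
      using that assms(3) by auto
    have "y = 0" if "- y = y" for y :: 'a
    proof -
      have "2 *\<^sub>R y = 0" using that by (metis scaleR_2 add.right_inverse)
      thus ?thesis by simp
    qed
    thus "y = y'" if "- y = y" "- y' = y'" for y y' :: 'a
      using that by blast
  qed (use assms in auto)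
  thus ?thesis by blast
qed

lemma even_card_if_two_eq_0:
  assumes "(2 :: 'k::{field,finite}) = 0"
  shows "even CARD('k)"
proof -
  have "of_nat 2 = (0 :: 'k)" using assms by simp
  hence "CHAR('k) dvd 2" using of_nat_eq_0_iff_char_dvd by blast
  moreover have "CHAR('k) \<noteq> 1" by simp
  ultimately have "CHAR('k) = 2" by (metis prime_nat_iff two_is_prime_nat)
  thus ?thesis using CHAR_dvd_CARD[where 'a = 'k] by simp
qed

text \<open>
  Negation preserves every linear code but fixes everything in characteristic two. There \<open>c \<mapsto> c + 1\<close>
  is an involution without fixed points, and applying it to all coordinates changes the product with
  a word \<open>v\<close> of the code by the sum of the coordinates of \<open>v\<close>.
\<close>
lemma dual_code_involution:
  fixes C :: "('k::{field,finite}^'l::finite) set"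
  assumes "odd CARD('k) \<or> zero_sum_code C"
  shows "\<exists>\<sigma>. (\<forall>c. \<sigma> (\<sigma> c) = c) \<and> (\<forall>c c'. \<sigma> c = c \<longrightarrow> \<sigma> c' = c' \<longrightarrow> c = c') \<and>
             (\<forall>x\<in>dual_code C. (\<chi> i. \<sigma> (x $ i)) \<in> dual_code C)"
proof (cases "(2 :: 'k) = 0")
  case True
  hence "zero_sum_code C" using assms even_card_if_two_eq_0 by blast
  moreover have "c + 1 + 1 = c" for c :: 'k
    using True by (metis add.assoc add_0_right one_add_one)
  ultimately show ?thesis
    by (intro exI[of _ "\<lambda>c. c + 1"])
      (auto simp: dual_code_def dot_def zero_sum_code_def algebra_simps sum.distrib)
next
  case False
  have zero: "c = 0" if "- c = c" for c :: 'k
  proof -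
    have "2 * c = 0" using that by (metis add.right_inverse mult_2)
    thus ?thesis using False by simp
  qed
  have "(\<chi> i. - (x $ i)) \<in> dual_code C" if "x \<in> dual_code C" for x
    using that by (simp add: dual_code_def dot_def sum_negf)
  moreover have "c = c'" if "- c = c" "- c' = c'" for c c' :: 'k
    using zero[OF that(1)] zero[OF that(2)] by simp
  ultimately show ?thesis
    by (intro exI[of _ uminus] conjI) (simp, blast+)
qed

theorem theorem1p1:
  fixes t l q k :: nat
    and \<mu> :: "(real^'n::finite) measure"
    and F :: "'l::finite \<Rightarrow> (real^'n) formula"
  assumes "t \<ge> 1"
    and "CARD('l) = l"
    and "CARD('k::{field,finite}) = q"
    and "prob_space \<mu>" and "sets \<mu> = sets borel" and "finite_moments \<mu>"
    and "\<And>i. finite (points (F i)) \<and> card (points (F i)) = q \<and> equal_weight (F i)"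
    and "cubature t \<mu> (convolution F)"
  shows "((\<exists>C::('k^'l) set. linear_code k (t + 1) C) \<longrightarrow>
            (\<exists>A. thinning t \<mu> F (q ^ (l - k)) A)) \<and>
         ((\<forall>i. centrally_symmetric (F i)) \<and> odd t \<and>
          (\<exists>C::('k^'l) set. linear_code k t C \<and> (odd q \<or> zero_sum_code C)) \<longrightarrow>
            (\<exists>A. thinning t \<mu> F (q ^ (l - k)) A))"
proof (intro conjI impI; (elim conjE)?; elim exE)
  have fin: "finite (points (F i))" and card: "card (points (F i)) = CARD('k)"
    and eq: "equal_weight (F i)" for i
    using assms(3,7) by auto
  have nonempty: "dual_code C \<noteq> {}" for C :: "('k^'l) set"
  proof -
    have "0 \<in> dual_code C" by (simp add: dual_code_def dot_def)
    thus ?thesis by blast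
  qed
  {
    fix C :: "('k^'l) set"
    assume C: "linear_code k (t + 1) C"
    have "\<exists>f. bij_betw f (UNIV :: 'k set) (points (F i))" for i
      by (rule finite_same_card_bij) (simp_all add: fin card)
    then obtain \<phi> :: "'l \<Rightarrow> 'k \<Rightarrow> real^'n" where \<phi>: "\<And>i. bij_betw (\<phi> i) UNIV (points (F i))"
      by metis
    have "thinning t \<mu> F (card (dual_code C)) ((\<lambda>x i. \<phi> i (x $ i)) ` dual_code C)"
      by (rule thinning_of_words[OF assms(4) eq assms(8) \<phi> nonempty])
        (rule orthogonal_array_monom[OF dual_code_orthogonal_array(1)[OF C] orthogonal_array_UNIV])
    thus "\<exists>A. thinning t \<mu> F (q ^ (l - k)) A"
      unfolding dual_code_orthogonal_array(2)[OF C] assms(2,3) by (rule exI)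
  }
  {
    fix C :: "('k^'l) set"
    assume sym: "\<forall>i. centrally_symmetric (F i)" and "odd t"
      and "linear_code k t C \<and> (odd q \<or> zero_sum_code C)"
    hence C: "linear_code k (t - 1 + 1) C" and odd_zero: "odd CARD('k) \<or> zero_sum_code C"
      using assms(1,3) by auto
    note OA = dual_code_orthogonal_array[OF C]
    obtain \<sigma> :: "'k \<Rightarrow> 'k" where \<sigma>: "\<And>c. \<sigma> (\<sigma> c) = c"
      and fix1: "\<And>c c'. \<sigma> c = c \<Longrightarrow> \<sigma> c' = c' \<Longrightarrow> c = c'"
      and D: "\<And>x. x \<in> dual_code C \<Longrightarrow> (\<chi> i. \<sigma> (x $ i)) \<in> dual_code C"
      using dual_code_involution[OF odd_zero] by metis
    have "\<exists>f. bij_betw f UNIV (points (F i)) \<and> (\<forall>c. f (\<sigma> c) = - f c)" for i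
    proof (rule exists_symmetric_labelling[OF fin card _ \<sigma> fix1])
      show "uminus ` points (F i) = points (F i)"
        using sym unfolding centrally_symmetric_def by blast
    qed
    then obtain \<phi> :: "'l \<Rightarrow> 'k \<Rightarrow> real^'n" where \<phi>: "\<And>i. bij_betw (\<phi> i) UNIV (points (F i))"
      and odd: "\<And>i c. \<phi> i (\<sigma> c) = - \<phi> i c"
      by metis
    have "thinning t \<mu> F (card (dual_code C)) ((\<lambda>x i. \<phi> i (x $ i)) ` dual_code C)"
    proof (rule thinning_of_words[OF assms(4) eq assms(8) \<phi> nonempty])
      fix \<alpha> :: "'n \<Rightarrow> nat"
      assume deg: "(\<Sum>i\<in>UNIV. \<alpha> i) \<le> t"
      show "real CARD('k^'l) * (\<Sum>x\<in>dual_code C. monom_fun \<alpha> (point_sum \<phi> x))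
          = real (card (dual_code C)) * (\<Sum>x\<in>UNIV. monom_fun \<alpha> (point_sum \<phi> x))"
      proof (cases "(\<Sum>i\<in>UNIV. \<alpha> i) = t")
        case True
        \<comment> \<open>The array has strength \<open>t - 1\<close> only, so the top degree needs the symmetry.\<close>
        hence odd_deg: "odd (\<Sum>i\<in>UNIV. \<alpha> i)" using \<open>odd t\<close> by simp
        have zero: "(\<Sum>x\<in>X. monom_fun \<alpha> (point_sum \<phi> x)) = 0"
          if "\<And>x. x \<in> X \<Longrightarrow> (\<chi> i. \<sigma> (x $ i)) \<in> X" for X
          using odd_monom_sum_eq_0[of \<phi> \<sigma>, OF odd \<sigma> that odd_deg] .
        show ?thesis using zero[of "dual_code C", OF D] zero[of UNIV] by simp
      next
        case False
        hence "(\<Sum>i\<in>UNIV. \<alpha> i) \<le> t - 1" using deg by simp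
        thus ?thesis by (rule orthogonal_array_monom[OF OA(1) orthogonal_array_UNIV])
      qed
    qed
    thus "\<exists>A. thinning t \<mu> F (q ^ (l - k)) A"
      unfolding OA(2) assms(2,3) by (rule exI)
  }
qed

end
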